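(* Let $\{V_n\}_{n\ge 0}$ be a generalized Tribonacci sequence with parameters $r,s,t$, let $\{O_{v,n}\}_{n\ge 0}$ be the associated generalized Tribonacci octonions, and let $\alpha,\omega_1,\omega_2$ be the roots of $x^3-rx^2-sx-t=0$. Then for all integers $n\geq 0$, $$P\,\underline{\alpha}\,\alpha^{n+2}=\alpha^{2} O_{v,n+2}+\alpha(sO_{v,n+1}+tO_{v,n})+ tO_{v,n+1},$$ $$Q\,\underline{\omega_{1}}\,\omega_{1}^{n+2}=\omega_{1}^{2} O_{v,n+2}+\omega_{1}(sO_{v,n+1}+tO_{v,n})+ tO_{v,n+1},$$ $$R\,\underline{\omega_{2}}\,\omega_{2}^{n+2}=\omega_{2}^{2} O_{v,n+2}+\omega_{2}(sO_{v,n+1}+tO_{v,n})+ tO_{v,n+1},$$ where $P=V_{2}-(\omega_{1}+\omega_{2})V_{1}+\omega_{1}\omega_{2}V_{0}$, $Q=V_{2}-(\alpha+\omega_{2})V_{1}+\alpha\omega_{2}V_{0}$, $R=V_{2}-(\alpha+\omega_{1})V_{1}+\alpha\omega_{1}V_{0}$, and $\underline{\alpha}=\sum_{l=0}^{7}\alpha^{l}e_{l}$, $\underline{\omega_{1}}=\sum_{l=0}^{7}\omega_{1}^{l}e_{l}$, $\underline{\omega_{2}}=\sum_{l=0}^{7}\omega_{2}^{l}e_{l}$.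
   Context: Generalized Tribonacci sequence: $r,s,t$ are real numbers, $V_0,V_1,V_2$ are arbitrary integers, and $V_n=rV_{n-1}+sV_{n-2}+tV_{n-3}$ for $n\ge 3$. Standing assumption: $\Delta=\frac{r^{3}t}{27}-\frac{r^{2}s^{2}}{108}+\frac{rst}{6}-\frac{s^{3}}{27}+\frac{t^{2}}{4}>0$, so that $x^3-rx^2-sx-t=0$ has one real root $\alpha$ and two nonreal complex conjugate roots $\omega_1,\omega_2$. Octonions: $\mathbb{O}$ is the real octonion algebra, an $8$-dimensional real vector space with basis $e_0=\mathbf{1},e_1,\dots,e_7$. The $n$-th generalized Tribonacci octonion is $O_{v,n}=\sum_{l=0}^{7}V_{n+l}e_l=V_n+\sum_{l=1}^{7}V_{n+l}e_l$, $n\ge 0$. Identities involving the complex numbers $\omega_1,\omega_2$ are read in the complexification $\mathbb{O}\otimes_{\mathbb{R}}\mathbb{C}$ (the complex vector space with basis $e_0,\dots,e_7$), where complex scalars multiply coefficientwise. *)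

theory Defs
  imports Complex_Main
begin

text \<open>
  Octonions with coefficients in \<open>'a\<close>: \<open>real octonion\<close> is the real octonion algebra, and
  \<open>complex octonion\<close> is its complexification. An octonion is its coefficient sequence with
  respect to \<open>e\<^sub>0, \<dots>, e\<^sub>7\<close>, padded with zeros.
\<close>

typedef (overloaded) 'a octonion = "{x :: nat \<Rightarrow> 'a :: zero. \<forall>l\<ge>8. x l = 0}"
  morphisms oct_coeff Abs_octonion
  by (rule exI[of _ "\<lambda>_. 0"]) simp

setup_lifting type_definition_octonion

instantiation octonion :: (ab_group_add) ab_group_add
begin

lift_definition zero_octonion :: "'a octonion" is "\<lambda>_. 0" by simp
lift_definition plus_octonion :: "'a octonion \<Rightarrow> 'a octonion \<Rightarrow> 'a octonion"
  is "\<lambda>x y l. x l + y l" by simp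
lift_definition minus_octonion :: "'a octonion \<Rightarrow> 'a octonion \<Rightarrow> 'a octonion"
  is "\<lambda>x y l. x l - y l" by simp
lift_definition uminus_octonion :: "'a octonion \<Rightarrow> 'a octonion"
  is "\<lambda>x l. - x l" by simp

instance
  by standard (transfer, simp add: algebra_simps fun_eq_iff)+

end

lift_definition oct_scale :: "'a \<Rightarrow> 'a octonion \<Rightarrow> 'a :: comm_ring_1 octonion" (infixr "*\<^sub>O" 75)
  is "\<lambda>c x l. c * x l" by simp

text \<open>The basis vector \<open>e\<^sub>l\<close>; only \<open>l \<le> 7\<close> is meaningful.\<close>

lift_definition oct_e :: "nat \<Rightarrow> 'a :: comm_ring_1 octonion"
  is "\<lambda>l k. if k = l \<and> l < 8 then 1 else 0" by auto

text \<open>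
  The product is the bilinear extension of the usual table: \<open>e\<^sub>0\<close> is the unit, the other
  \<open>e\<^sub>i\<close> square to \<open>-e\<^sub>0\<close> and anticommute, and \<open>e\<^sub>i e\<^sub>j = e\<^sub>k\<close> for every cyclic rotation
  \<open>(i, j, k)\<close> of one of the seven oriented lines of the Fano plane below.
\<close>

definition fano_lines :: "(nat \<times> nat \<times> nat) set" where
  "fano_lines = {(1,2,3), (1,4,5), (1,7,6), (2,4,6), (2,5,7), (3,4,7), (3,6,5)}"

definition fano_cyclic :: "nat \<Rightarrow> nat \<Rightarrow> nat \<Rightarrow> bool" where
  "fano_cyclic i j k \<longleftrightarrow>
     (i, j, k) \<in> fano_lines \<or> (j, k, i) \<in> fano_lines \<or> (k, i, j) \<in> fano_lines"

text \<open>The coefficient of \<open>e\<^sub>k\<close> in \<open>e\<^sub>i e\<^sub>j\<close>, for \<open>i, j, k \<le> 7\<close>.\<close>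

definition oct_struct :: "nat \<Rightarrow> nat \<Rightarrow> nat \<Rightarrow> 'a :: comm_ring_1" where
  "oct_struct i j k =
     (if i = 0 then (if k = j then 1 else 0)
      else if j = 0 then (if k = i then 1 else 0)
      else if i = j then (if k = 0 then - 1 else 0)
      else if fano_cyclic i j k then 1
      else if fano_cyclic j i k then - 1
      else 0)"

instantiation octonion :: (comm_ring_1) "{one, times}"
begin

definition one_octonion :: "'a octonion" where
  "one_octonion = oct_e 0"

lift_definition times_octonion :: "'a octonion \<Rightarrow> 'a octonion \<Rightarrow> 'a octonion"
  is "\<lambda>x y k. if k < 8 then \<Sum>i<8. \<Sum>j<8. oct_struct i j k * x i * y j else 0"
  by simp

instance ..

end

text \<open>The inclusion of the real octonions into their complexification.\<close>

lift_definition oct_complexify :: "real octonion \<Rightarrow> complex octonion"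
  is "\<lambda>x l. complex_of_real (x l)" by simp

text \<open>
  Only the initial values are integers; since \<open>r, s, t\<close> are real, the later terms are real.
\<close>

definition gen_tribonacci :: "real \<Rightarrow> real \<Rightarrow> real \<Rightarrow> (nat \<Rightarrow> real) \<Rightarrow> bool" where
  "gen_tribonacci r s t V \<longleftrightarrow>
     V 0 \<in> \<int> \<and> V 1 \<in> \<int> \<and> V 2 \<in> \<int> \<and>
     (\<forall>n\<ge>3. V n = r * V (n - 1) + s * V (n - 2) + t * V (n - 3))"

definition trib_discr :: "real \<Rightarrow> real \<Rightarrow> real \<Rightarrow> real" where
  "trib_discr r s t =
     r^3 * t / 27 - r^2 * s^2 / 108 + r * s * t / 6 - s^3 / 27 + t^2 / 4"

definition trib_octonion :: "(nat \<Rightarrow> real) \<Rightarrow> nat \<Rightarrow> real octonion" where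
  "trib_octonion V n = (\<Sum>l=0..7. V (n + l) *\<^sub>O oct_e l)"

text \<open>The octonion written as an underlined scalar, e.g. \<open>\<alpha>\<close> underlined.\<close>

definition oct_geom :: "complex \<Rightarrow> complex octonion" where
  "oct_geom z = (\<Sum>l=0..7. z ^ l *\<^sub>O oct_e l)"

end

theory Submission
  imports Defs
begin

text \<open>
  Each identity is a statement about eight scalar coefficients, and the \<open>l\<close>-th coefficient is the
  same scalar identity at the index \<open>n + l\<close>. For the scalar identity, let \<open>z, a, b\<close> be the roots, counted with multiplicity. The recurrence is annihilated by
  \<open>(E - z)(E - a)(E - b)\<close>, where \<open>E\<close> is the shift, so applying \<open>(E - a)(E - b)\<close> to \<open>V\<close> leaves a
  geometric sequence of ratio \<open>z\<close> (lemma \<open>deflated_recurrence_geometric\<close>). Its initial value is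
  \<open>P\<close>, \<open>Q\<close> or \<open>R\<close>. Multiplying its general term by \<open>z\<^sup>2\<close> and eliminating \<open>a, b\<close> by Vieta's
  relations \<open>z * a * b = t\<close> and \<open>z * (a + b) + a * b = - s\<close> gives the right-hand side
  (lemma \<open>root_power_identity\<close>).

  Vieta's relations hold for roots counted with multiplicity, whereas the hypothesis describes only
  the set of roots. The discriminant closes this gap: it is a nonzero multiple of
  \<open>((z - a) * (z - b) * (a - b))\<^sup>2\<close>, so the three roots are distinct and the set determines them
  (lemma \<open>vieta_of_root_set\<close>).
\<close>

section \<open>Coefficients of octonions\<close>

lemma octonion_eqI:
  assumes "\<And>l. l < 8 \<Longrightarrow> oct_coeff x l = oct_coeff y l"
  shows "x = y"
proof -
  have "oct_coeff x l = oct_coeff y l" for l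
    using assms[of l] oct_coeff[of x] oct_coeff[of y] by (cases "l < 8") auto
  then show ?thesis
    by (metis oct_coeff_inject ext)
qed

lemma oct_coeff_sum: "oct_coeff (\<Sum>i\<in>A. f i) l = (\<Sum>i\<in>A. oct_coeff (f i) l)"
  by (induction A rule: infinite_finite_induct)
    (simp_all add: zero_octonion.rep_eq plus_octonion.rep_eq)

lemma oct_coeff_basis_expansion:
  assumes "l < 8"
  shows "oct_coeff (\<Sum>k=0..7. f k *\<^sub>O oct_e k) l = f l"
proof -
  have "oct_coeff (\<Sum>k=0..7. f k *\<^sub>O oct_e k) l = (\<Sum>k=0..7. if k = l then f k else 0)"
    unfolding oct_coeff_sum using assms
    by (intro sum.cong) (auto simp: oct_scale.rep_eq oct_e.rep_eq)
  then show ?thesis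
    using assms by simp
qed

section \<open>Linear recurrences of order three\<close>

lemma deflated_recurrence_geometric:
  fixes W :: "nat \<Rightarrow> 'a :: comm_ring_1"
  assumes rec: "\<And>m. W (m + 3) = (z + a + b) * W (m + 2) - (z * a + z * b + a * b) * W (m + 1)
                          + z * a * b * W m"
  shows "W (m + 2) - (a + b) * W (m + 1) + a * b * W m
           = z ^ m * (W 2 - (a + b) * W 1 + a * b * W 0)"
proof (induction m)
  case 0
  then show ?case by (simp add: numeral_2_eq_2)
next
  case (Suc m)
  have "W (Suc m + 2) - (a + b) * W (Suc m + 1) + a * b * W (Suc m)
          = z * (W (m + 2) - (a + b) * W (m + 1) + a * b * W m)"
    using rec[of m] by (simp add: numeral_3_eq_3 algebra_simps)
  then show ?case
    unfolding Suc.IH by (simp add: mult.assoc)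
qed

text \<open>
  The scalar form of the theorem. The left factor is symmetric in the two roots other than \<open>z\<close>,
  so the same identity serves for every choice of \<open>z\<close> among the three roots.
\<close>

lemma root_power_identity:
  fixes W :: "nat \<Rightarrow> 'a :: comm_ring_1"
  assumes rec: "\<And>m. W (m + 3) = r * W (m + 2) + s * W (m + 1) + t * W m"
    and vieta: "r = z + a + b" "s = - (z * a + z * b + a * b)" "t = z * a * b"
  shows "(W 2 - (a + b) * W 1 + a * b * W 0) * z ^ (m + 2)
           = z ^ 2 * W (m + 2) + z * (s * W (m + 1) + t * W m) + t * W (m + 1)"
proof -
  have "W (m + 3) = (z + a + b) * W (m + 2) - (z * a + z * b + a * b) * W (m + 1)
          + z * a * b * W m" for m
    unfolding rec[of m] vieta by (simp add: algebra_simps)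
  then have geometric: "z ^ m * (W 2 - (a + b) * W 1 + a * b * W 0)
          = W (m + 2) - (a + b) * W (m + 1) + a * b * W m"
    by (rule deflated_recurrence_geometric[symmetric])
  have "(W 2 - (a + b) * W 1 + a * b * W 0) * z ^ (m + 2)
          = z ^ 2 * (z ^ m * (W 2 - (a + b) * W 1 + a * b * W 0))"
    by (simp only: power_add ac_simps)
  also have "\<dots> = z ^ 2 * (W (m + 2) - (a + b) * W (m + 1) + a * b * W m)"
    by (simp only: geometric)
  also have "\<dots> = z ^ 2 * W (m + 2) + z * (s * W (m + 1) + t * W m) + t * W (m + 1)"
    by (simp add: vieta power2_eq_square algebra_simps)
  finally show ?thesis .
qed

section \<open>The roots of the characteristic cubic\<close>

lemma trib_discr_vieta:
  fixes x y z :: complex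
  assumes "of_real r = x + y + z" "of_real s = - (x * y + x * z + y * z)" "of_real t = x * y * z"
  shows "- 108 * of_real (trib_discr r s t) = ((x - y) * (x - z) * (y - z)) ^ 2"
  unfolding trib_discr_def of_real_add of_real_diff of_real_mult of_real_divide of_real_power
    of_real_numeral assms
  by (simp add: field_simps) algebra

text \<open>
  Dividing the cubic by \<open>x - \<alpha>\<close> leaves a quadratic, whose roots \<open>u, v\<close> are given by the usual
  formula. Together with \<open>\<alpha>\<close> they satisfy Vieta's relations, hence are all the roots, and the
  discriminant makes \<open>\<alpha>, u, v\<close> distinct. So \<open>{u, v} = {\<omega>1, \<omega>2}\<close>, and \<open>\<omega>1, \<omega>2\<close> inherit the
  symmetric relations.
\<close>

lemma vieta_of_root_set:
  fixes r s t :: real and \<alpha> \<omega>1 \<omega>2 :: complex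
  assumes discr: "trib_discr r s t \<noteq> 0"
    and roots: "{z :: complex. z^3 - of_real r * z^2 - of_real s * z - of_real t = 0}
                  = {\<alpha>, \<omega>1, \<omega>2}"
  shows "of_real r = \<alpha> + \<omega>1 + \<omega>2" "of_real s = - (\<alpha> * \<omega>1 + \<alpha> * \<omega>2 + \<omega>1 * \<omega>2)"
    "of_real t = \<alpha> * \<omega>1 * \<omega>2"
proof -
  define p q where "p = of_real r - \<alpha>" and "q = \<alpha> ^ 2 - of_real r * \<alpha> - of_real s"
  define d where "d = csqrt (p ^ 2 - 4 * q)"
  define u v where "u = (p + d) / 2" and "v = (p - d) / 2"
  have "\<alpha> ^ 3 - of_real r * \<alpha> ^ 2 - of_real s * \<alpha> - of_real t = 0"
    using roots by blast
  then have t_eq: "of_real t = \<alpha> * q"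
    by (simp add: q_def power2_eq_square power3_eq_cube algebra_simps)
  have uv_sum: "u + v = p"
    by (simp add: u_def v_def field_simps)
  have "d ^ 2 = p ^ 2 - 4 * q"
    by (simp add: d_def)
  then have uv_prod: "u * v = q"
    by (simp add: u_def v_def field_simps power2_eq_square)
  have vr: "of_real r = \<alpha> + u + v"
    using uv_sum by (simp add: p_def algebra_simps)
  have vs: "of_real s = - (\<alpha> * u + \<alpha> * v + u * v)"
    using uv_prod vr by (simp add: q_def power2_eq_square algebra_simps)
  have vt: "of_real t = \<alpha> * u * v"
    using t_eq uv_prod by (simp add: mult.assoc)
  have "z ^ 3 - of_real r * z ^ 2 - of_real s * z - of_real t = (z - \<alpha>) * (z - u) * (z - v)" for z
    unfolding vr vs vt by (simp add: power2_eq_square power3_eq_cube algebra_simps)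
  then have sets: "{\<alpha>, u, v} = {\<alpha>, \<omega>1, \<omega>2}"
    using roots by auto
  have "((\<alpha> - u) * (\<alpha> - v) * (u - v)) ^ 2 \<noteq> 0"
    using trib_discr_vieta[OF vr vs vt] discr by (metis mult_eq_0_iff neg_equal_0_iff_equal
        of_real_eq_0_iff zero_neq_numeral)
  then have "\<alpha> \<noteq> u" "\<alpha> \<noteq> v" "u \<noteq> v"
    by auto
  with sets have "u = \<omega>1 \<and> v = \<omega>2 \<or> u = \<omega>2 \<and> v = \<omega>1"
    by (auto simp: set_eq_iff; metis)
  then show "of_real r = \<alpha> + \<omega>1 + \<omega>2" "of_real s = - (\<alpha> * \<omega>1 + \<alpha> * \<omega>2 + \<omega>1 * \<omega>2)"
    "of_real t = \<alpha> * \<omega>1 * \<omega>2"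
    by (elim disjE conjE; simp only: vr vs vt ac_simps)+
qed

section \<open>Generalized Tribonacci octonions\<close>

lemma gen_tribonacci_step:
  assumes "gen_tribonacci r s t V"
  shows "V (m + 3) = r * V (m + 2) + s * V (m + 1) + t * V m"
proof -
  have "m + 3 \<ge> 3" "m + 3 - 1 = m + 2" "m + 3 - 2 = m + 1" "m + 3 - 3 = m"
    by simp_all
  then show ?thesis
    using assms unfolding gen_tribonacci_def by metis
qed

lemma trib_octonion_root_identity:
  fixes z a b :: complex
  assumes trib: "gen_tribonacci r s t V"
    and vieta: "of_real r = z + a + b" "of_real s = - (z * a + z * b + a * b)"
      "of_real t = z * a * b"
    and S: "S = of_real (V 2) - (a + b) * of_real (V 1) + a * b * of_real (V 0)"
  shows "(S * z ^ (n + 2)) *\<^sub>O oct_geom z =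
       z ^ 2 *\<^sub>O oct_complexify (trib_octonion V (n + 2))
       + z *\<^sub>O oct_complexify (s *\<^sub>O trib_octonion V (n + 1) + t *\<^sub>O trib_octonion V n)
       + oct_complexify (t *\<^sub>O trib_octonion V (n + 1))"
proof (rule octonion_eqI)
  fix l :: nat
  assume l: "l < 8"
  have "complex_of_real (V (m + 3))
          = of_real r * of_real (V (m + 2)) + of_real s * of_real (V (m + 1))
            + of_real t * of_real (V m)" for m
    using gen_tribonacci_step[OF trib, of m] by simp
  from root_power_identity[where W = "\<lambda>m. complex_of_real (V m)", OF this vieta, of "n + l"]
  have *: "S * z ^ (n + 2) * z ^ l = z ^ 2 * of_real (V (n + 2 + l))
          + z * (of_real s * of_real (V (n + 1 + l)) + of_real t * of_real (V (n + l)))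
          + of_real t * of_real (V (n + 1 + l))"
    by (simp add: S power_add ac_simps)
  have trib_coeff: "oct_coeff (trib_octonion V k) l = V (k + l)" for k
    unfolding trib_octonion_def by (rule oct_coeff_basis_expansion[OF l])
  have geom_coeff: "oct_coeff (oct_geom z) l = z ^ l"
    unfolding oct_geom_def by (rule oct_coeff_basis_expansion[OF l])
  show "oct_coeff ((S * z ^ (n + 2)) *\<^sub>O oct_geom z) l =
      oct_coeff (z ^ 2 *\<^sub>O oct_complexify (trib_octonion V (n + 2))
       + z *\<^sub>O oct_complexify (s *\<^sub>O trib_octonion V (n + 1) + t *\<^sub>O trib_octonion V n)
       + oct_complexify (t *\<^sub>O trib_octonion V (n + 1))) l"
    unfolding plus_octonion.rep_eq oct_scale.rep_eq oct_complexify.rep_eq trib_coeff geom_coeff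
      of_real_add of_real_mult
    by (rule *)
qed

theorem theorem3p6:
  fixes r s t \<alpha> :: real and \<omega>1 \<omega>2 P Q R :: complex and V :: "nat \<Rightarrow> real" and n :: nat
  assumes "gen_tribonacci r s t V"
    and "trib_discr r s t > 0"
    and "{z :: complex. z^3 - of_real r * z^2 - of_real s * z - of_real t = 0}
           = {of_real \<alpha>, \<omega>1, \<omega>2}"
    and "P = of_real (V 2) - (\<omega>1 + \<omega>2) * of_real (V 1) + \<omega>1 * \<omega>2 * of_real (V 0)"
    and "Q = of_real (V 2) - (of_real \<alpha> + \<omega>2) * of_real (V 1) + of_real \<alpha> * \<omega>2 * of_real (V 0)"
    and "R = of_real (V 2) - (of_real \<alpha> + \<omega>1) * of_real (V 1) + of_real \<alpha> * \<omega>1 * of_real (V 0)"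
  shows
    "((P * of_real \<alpha> ^ (n + 2)) *\<^sub>O oct_geom (of_real \<alpha>) =
       of_real \<alpha> ^ 2 *\<^sub>O oct_complexify (trib_octonion V (n + 2))
       + of_real \<alpha> *\<^sub>O oct_complexify (s *\<^sub>O trib_octonion V (n + 1) + t *\<^sub>O trib_octonion V n)
       + oct_complexify (t *\<^sub>O trib_octonion V (n + 1)))
     \<and> ((Q * \<omega>1 ^ (n + 2)) *\<^sub>O oct_geom \<omega>1 =
       \<omega>1 ^ 2 *\<^sub>O oct_complexify (trib_octonion V (n + 2))
       + \<omega>1 *\<^sub>O oct_complexify (s *\<^sub>O trib_octonion V (n + 1) + t *\<^sub>O trib_octonion V n)
       + oct_complexify (t *\<^sub>O trib_octonion V (n + 1)))
     \<and> ((R * \<omega>2 ^ (n + 2)) *\<^sub>O oct_geom \<omega>2 =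
       \<omega>2 ^ 2 *\<^sub>O oct_complexify (trib_octonion V (n + 2))
       + \<omega>2 *\<^sub>O oct_complexify (s *\<^sub>O trib_octonion V (n + 1) + t *\<^sub>O trib_octonion V n)
       + oct_complexify (t *\<^sub>O trib_octonion V (n + 1)))"
proof -
  have "trib_discr r s t \<noteq> 0"
    using assms(2) by simp
  note vieta = vieta_of_root_set[OF this assms(3)]
  show ?thesis
    by (intro conjI; rule trib_octonion_root_identity[OF assms(1)])
      (use assms(4-6) vieta in \<open>simp_all add: algebra_simps\<close>)
qed

end
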